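(* Let $E$ be an AL-space and let $\mathcal{T} = (T_t)_{t \in J}$ be a bounded positive semigroup on $E$, where either $J = \mathbb{N}$ or $J =(0,\infty)$. Then the following assertions are equivalent: (i) $\mathcal{T}$ converges with respect to the operator norm (as $t\to\infty$) to the rank-1 projection $P=\varphi \otimes f_0$, where $f_0\in E_+$ is a normalised fixed vector of $\mathcal{T}$ and $\varphi\in E'$ is a positive fixed functional of $\mathcal{T}$ such that $\langle\varphi, f_0\rangle =1$ and $\langle\varphi, f\rangle \geq \varepsilon$ for all $f \in E_+$ of norm $1$ and some constant $\varepsilon > 0$. (ii) There exists a vector $0 < h \in E$ such that $$\lim_{t\to\infty} \sup \bigl\{\|(T_tf-h)^-\| : f \in E_+,\ \|f\| = 1 \bigr\} =0.$$
   Context: All spaces are real. $\mathbb{N} = \{1,2,\dots\}$. An AL-space is a Banach lattice $E$ with $\|f+g\| = \|f\|+\|g\|$ for all $f,g \in E_+$, where $E_+$ is the positive cone. A semigroup on $E$ is a family $(T_t)_{t \in J}$ of bounded linear operators on $E$ with $T_{t+s} = T_tT_s$ for all $s,t \in J$; no continuity in $t$ is assumed. It is bounded if $\sup_{t\in J}\|T_t\|<\infty$, and positive if $T_tE_+\subseteq E_+$ for all $t \in J$. A fixed vector is $f \in E$ with $T_tf = f$ for all $t \in J$; a fixed functional is $\varphi \in E'$ (the dual space) with $T_t'\varphi = \varphi$ for all $t\in J$, where $T_t'$ is the adjoint. $(\varphi\otimes f_0)g = \langle \varphi,g\rangle f_0$. Normalised means of norm $1$. $0<h$ means $h \ge 0$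 and $h \ne 0$; $g^- = (-g)\vee 0$. *)

theory Defs
  imports "HOL-Analysis.Analysis" "HOL-Library.Lattice_Algebras"
begin

class banach_lattice = banach + ordered_real_vector + lattice_ab_group_add_abs +
  assumes norm_mono_abs: "\<bar>x\<bar> \<le> \<bar>y\<bar> \<Longrightarrow> norm x \<le> norm y"

class al_space = banach_lattice +
  assumes norm_add_pos: "0 \<le> x \<Longrightarrow> 0 \<le> y \<Longrightarrow> norm (x + y) = norm x + norm y"

instance real :: al_space
  by standard auto

definition neg_part :: "'a::lattice_ab_group_add \<Rightarrow> 'a" where
  "neg_part g = sup (- g) 0"

text \<open>For codomain \<open>real\<close> this is positivity of a functional.\<close>

definition positive_op ::
    "('a::{real_normed_vector,ord} \<Rightarrow>\<^sub>L 'b::{real_normed_vector,ord}) \<Rightarrow> bool" where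
  "positive_op A \<longleftrightarrow> (\<forall>f\<ge>0. 0 \<le> blinfun_apply A f)"

definition adjoint_op ::
    "('a::real_normed_vector \<Rightarrow>\<^sub>L 'a) \<Rightarrow> ('a \<Rightarrow>\<^sub>L real) \<Rightarrow> ('a \<Rightarrow>\<^sub>L real)" where
  "adjoint_op A \<phi> = \<phi> o\<^sub>L A"

definition rank_one ::
    "('a::real_normed_vector \<Rightarrow>\<^sub>L real) \<Rightarrow> 'b::real_normed_vector \<Rightarrow> ('a \<Rightarrow>\<^sub>L 'b)" where
  "rank_one \<phi> f0 = blinfun_scaleR_left f0 o\<^sub>L \<phi>"

lemma rank_one_apply [simp]: "blinfun_apply (rank_one \<phi> f0) g = blinfun_apply \<phi> g *\<^sub>R f0"
  by (simp add: rank_one_def)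

lemma rank_one_projection:
  assumes "blinfun_apply \<phi> f0 = 1"
  shows "rank_one \<phi> f0 o\<^sub>L rank_one \<phi> f0 = rank_one \<phi> f0"
    and "range (blinfun_apply (rank_one \<phi> f0)) = span {f0}"
proof -
  show "rank_one \<phi> f0 o\<^sub>L rank_one \<phi> f0 = rank_one \<phi> f0"
    by (rule blinfun_eqI) (simp add: assms blinfun.scaleR_right)
  have "c *\<^sub>R f0 \<in> range (blinfun_apply (rank_one \<phi> f0))" for c
    by (rule range_eqI[where x = "c *\<^sub>R f0"]) (simp add: assms blinfun.scaleR_right)
  then show "range (blinfun_apply (rank_one \<phi> f0)) = span {f0}"
    by (auto simp: span_singleton)
qed

text \<open>
  A family is a function on all of \<open>real\<close>; only its values on the time set \<open>J\<close> matter.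
\<close>

definition op_semigroup ::
    "real set \<Rightarrow> (real \<Rightarrow> 'a::real_normed_vector \<Rightarrow>\<^sub>L 'a) \<Rightarrow> bool" where
  "op_semigroup J T \<longleftrightarrow> (\<forall>t\<in>J. \<forall>s\<in>J. T (t + s) = T t o\<^sub>L T s)"

definition bounded_semigroup ::
    "real set \<Rightarrow> (real \<Rightarrow> 'a::real_normed_vector \<Rightarrow>\<^sub>L 'a) \<Rightarrow> bool" where
  "bounded_semigroup J T \<longleftrightarrow> op_semigroup J T \<and> bdd_above ((\<lambda>t. norm (T t)) ` J)"

definition positive_semigroup ::
    "real set \<Rightarrow> (real \<Rightarrow> 'a::{real_normed_vector,ord} \<Rightarrow>\<^sub>L 'a) \<Rightarrow> bool" where
  "positive_semigroup J T \<longleftrightarrow> op_semigroup J T \<and> (\<forall>t\<in>J. positive_op (T t))"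

definition fixed_vector ::
    "real set \<Rightarrow> (real \<Rightarrow> 'a::real_normed_vector \<Rightarrow>\<^sub>L 'a) \<Rightarrow> 'a \<Rightarrow> bool" where
  "fixed_vector J T f \<longleftrightarrow> (\<forall>t\<in>J. blinfun_apply (T t) f = f)"

definition fixed_functional ::
    "real set \<Rightarrow> (real \<Rightarrow> 'a::real_normed_vector \<Rightarrow>\<^sub>L 'a) \<Rightarrow> ('a \<Rightarrow>\<^sub>L real) \<Rightarrow> bool" where
  "fixed_functional J T \<phi> \<longleftrightarrow> (\<forall>t\<in>J. adjoint_op (T t) \<phi> = \<phi>)"

text \<open>The filter of \<open>t \<rightarrow> \<infinity>\<close> with \<open>t\<close> restricted to \<open>J\<close>.\<close>

definition at_top_in :: "real set \<Rightarrow> real filter" where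
  "at_top_in J = inf at_top (principal J)"

lemma eventually_at_top_in:
  "eventually P (at_top_in J) \<longleftrightarrow> (\<exists>t0. \<forall>t\<in>J. t0 \<le> t \<longrightarrow> P t)"
  by (auto simp: at_top_in_def eventually_inf_principal eventually_at_top_linorder)

end

theory Submission
  imports Defs
begin

text \<open>
  If \<open>T t \<rightarrow> \<phi> \<otimes> f0\<close> and \<open>\<phi> \<ge> \<epsilon>\<close> on the positive unit sphere, then for \<open>f\<close> in
  that sphere \<open>T t f - \<epsilon> f0\<close> differs from the positive vector \<open>(\<phi> f - \<epsilon>) f0\<close> by at most the operator norm distance, so \<open>h = \<epsilon> f0\<close> is a uniform
  lower bound (\<open>rank_one_limit_imp_lower_bound\<close>).

  The converse is a Doeblin argument. For Markov operators, which preserve the norm on the cone, it is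
  classical: if the images of two positive vectors of equal mass both dominate the same multiple of
  \<open>h\<close>, then that common part cancels in their difference, so the operator is a strict contraction on
  the vectors of total mass zero. Here the operators are only bounded and a mass that they preserve
  has to be found first. The lower bound \<open>h\<close> yields one: it forces
  \<open>c \<parallel>f\<parallel> \<le> \<parallel>T t f\<parallel> \<le> M \<parallel>f\<parallel>\<close> for positive \<open>f\<close> and all large \<open>t\<close>. On an AL-space the norm extends from
  the cone to a linear functional, and a cluster point of the Cesaro means of this functional along
  the orbits of a single operator \<open>S = T t0\<close> is an invariant positive functional \<open>\<phi>\<close> with
  \<open>c \<parallel>f\<parallel> \<le> \<phi> f \<le> M \<parallel>f\<parallel>\<close> on the cone (\<open>invariant_functional_exists\<close>). So \<open>f \<mapsto> \<phi> \<bar>f\<bar>\<close> is an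
  equivalent norm for which \<open>S\<close> is Markov; by \<open>contraction_on_kernel\<close>, \<open>S\<close> contracts the kernel of
  \<open>\<phi>\<close>, and its powers converge geometrically to a rank-one projection
  (\<open>powers_converge_to_rank_one\<close>).

  The passage from \<open>S\<close> to the semigroup uses commutation. Each \<open>T t\<close> commutes with \<open>S\<close>, hence with the
  limit projection, so \<open>f0\<close> is an eigenvector of \<open>T t\<close> for some eigenvalue \<open>l \<ge> 0\<close>. All high powers of
  \<open>l\<close> lie between the constants \<open>c > 0\<close> and \<open>M\<close>, which forces \<open>l = 1\<close>.
  Thus \<open>f0\<close> and \<open>\<phi>\<close> are fixed by the whole semigroup, and splitting \<open>t = k t0 + r\<close> transfers the
  convergence of \<open>S ^ k\<close> to \<open>T t\<close>.
\<close>

section \<open>The norm of an AL-space as a linear functional on the cone\<close>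

lemma parts_diff: "pprt f - pprt (- f) = (f :: 'a::lattice_ab_group_add)"
  using prts[of f] by (simp add: pprt_neg)

lemma abs_parts: "pprt f + pprt (- f) = \<bar>f :: 'a::lattice_ab_group_add_abs\<bar>"
  by (simp add: abs_prts pprt_neg)

lemma norm_mono_nonneg:
  fixes x y :: "'a::banach_lattice"
  assumes "0 \<le> x" "x \<le> y"
  shows "norm x \<le> norm y"
  by (rule norm_mono_abs) (use assms in \<open>simp add: order_trans[OF assms]\<close>)

lemma norm_abs_eq: "norm \<bar>f\<bar> = norm (f :: 'a::banach_lattice)"
  by (intro antisym norm_mono_abs) simp_all

lemma neg_part_le:
  fixes e :: "'a::lattice_ab_group_add"
  assumes "0 \<le> e" "0 \<le> g + e"
  shows "neg_part g \<le> e"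
proof -
  have "- g \<le> e" using add_left_mono[OF assms(2), of "- g"] by simp
  then show ?thesis using assms(1) by (simp add: neg_part_def)
qed

lemma neg_part_nonneg: "0 \<le> neg_part g"
  by (simp add: neg_part_def)

lemma add_neg_part_nonneg: "0 \<le> g + neg_part (g :: 'a::lattice_ab_group_add)"
proof -
  have "- g \<le> neg_part g" by (simp add: neg_part_def)
  then show ?thesis by (metis add.commute diff_ge_0_iff_ge diff_minus_eq_add)
qed

text \<open>
  The negative part of \<open>g\<close> is at most its distance to any positive vector. With \<open>x\<close> chosen suitably, this
  gives closedness of the cone, the boundedness of the suprema of negative parts, and the easy
  direction of the equivalence.
\<close>

lemma norm_neg_part_le:
  fixes x g :: "'a::banach_lattice"
  assumes "0 \<le> x"
  shows "norm (neg_part g) \<le> norm (g - x)"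
proof -
  have "0 \<le> (g - x) + \<bar>g - x\<bar>"
    using add_left_mono[OF abs_ge_minus_self[of "g - x"], of "g - x"] by simp
  then have "0 \<le> x + ((g - x) + \<bar>g - x\<bar>)"
    using assms by (rule add_nonneg_nonneg[rotated])
  then have "neg_part g \<le> \<bar>g - x\<bar>"
    by (intro neg_part_le) (simp_all add: algebra_simps)
  then show ?thesis
    using norm_mono_nonneg[OF neg_part_nonneg] by (metis norm_abs_eq)
qed

lemma nonneg_limit:
  fixes x :: "nat \<Rightarrow> 'a::banach_lattice"
  assumes lim: "x \<longlonglongrightarrow> l" and nonneg: "\<And>n. 0 \<le> x n"
  shows "0 \<le> l"
proof -
  have "(\<lambda>n. norm (l - x n)) \<longlonglongrightarrow> 0"
    using tendsto_norm_zero[OF tendsto_diff[OF tendsto_const[of l] lim, simplified]] by simp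
  then have "norm (neg_part l) \<le> 0"
    by (rule LIMSEQ_le_const) (use norm_neg_part_le[OF nonneg] in blast)
  then show ?thesis
    using add_neg_part_nonneg[of l] by simp
qed

text \<open>
  On an AL-space this is the unique linear functional that agrees with the norm on the cone; on
  \<open>L\<^sup>1\<close> it is the integral.
\<close>

definition mass :: "'a::banach_lattice \<Rightarrow> real" where
  "mass f = norm (pprt f) - norm (pprt (- f))"

text \<open>
  The decomposition into positive and negative parts may be replaced by any other difference of positive
  vectors, because the norm is additive on the cone. Linearity of \<open>mass\<close> rests on this freedom.
\<close>

lemma mass_diff:
  fixes a b :: "'a::al_space"
  assumes "0 \<le> a" "0 \<le> b"
  shows "mass (a - b) = norm a - norm b"
proof -
  have "a + pprt (- (a - b)) = b + pprt (a - b)"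
    using parts_diff[of "a - b"] by (simp add: algebra_simps)
  then have "norm a + norm (pprt (- (a - b))) = norm b + norm (pprt (a - b))"
    using norm_add_pos[OF assms(1) zero_le_pprt] norm_add_pos[OF assms(2) zero_le_pprt] by metis
  then show ?thesis unfolding mass_def by linarith
qed

lemma mass_nonneg_eq: "0 \<le> f \<Longrightarrow> mass f = norm (f :: 'a::al_space)"
  using mass_diff[of f 0] by simp

lemma abs_mass_le: "\<bar>mass f\<bar> \<le> norm (f :: 'a::al_space)"
proof -
  have "norm f = norm (pprt f) + norm (pprt (- f))"
    by (metis abs_parts norm_abs_eq norm_add_pos zero_le_pprt)
  then show ?thesis
    using norm_ge_zero[of "pprt f"] norm_ge_zero[of "pprt (- f)"] unfolding mass_def by linarith
qed

lemma linear_mass: "linear (mass :: 'a::al_space \<Rightarrow> real)"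
proof
  fix f g :: 'a
  have "mass (f + g) = mass ((pprt f + pprt g) - (pprt (- f) + pprt (- g)))"
    using parts_diff[of f] parts_diff[of g] by (metis add_diff_add)
  then show "mass (f + g) = mass f + mass g"
    by (subst (asm) mass_diff) (simp_all add: norm_add_pos mass_def add_nonneg_nonneg)
next
  fix r :: real and f :: 'a
  show "mass (r *\<^sub>R f) = r *\<^sub>R mass f"
  proof (cases "0 \<le> r")
    case True
    have "mass (r *\<^sub>R f) = mass (r *\<^sub>R pprt f - r *\<^sub>R pprt (- f))"
      by (metis parts_diff scaleR_right_diff_distrib)
    then show ?thesis
      using True by (subst (asm) mass_diff) (simp_all add: mass_def scaleR_nonneg_nonneg algebra_simps)
  next
    case False
    have "r *\<^sub>R f = r *\<^sub>R (pprt f - pprt (- f))" by (simp add: parts_diff)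
    also have "\<dots> = (- r) *\<^sub>R pprt (- f) - (- r) *\<^sub>R pprt f" by (simp add: algebra_simps)
    finally have "mass (r *\<^sub>R f) = mass ((- r) *\<^sub>R pprt (- f) - (- r) *\<^sub>R pprt f)"
      by simp
    then show ?thesis
      using False
      by (subst (asm) mass_diff) (simp_all add: mass_def scaleR_nonneg_nonneg algebra_simps del: scaleR_minus_left)
  qed
qed

section \<open>An invariant functional from Cesaro means\<close>

text \<open>
  Tychonoff's theorem: the functions bounded by \<open>K\<close> form a compact set for pointwise convergence, so the
  sequence has a cluster point there. Stating the convergence along a filter of indices finer than
  \<open>sequentially\<close> lets every eventual or limiting property of the sequence carry over to \<open>\<phi>\<close>; a
  convergent subsequence need not exist.
\<close>

lemma pointwise_cluster_function:
  fixes x :: "nat \<Rightarrow> 'b \<Rightarrow> real"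
  assumes "\<And>n f. \<bar>x n f\<bar> \<le> K f"
  obtains F \<phi> where "F \<noteq> bot" "F \<le> sequentially" "\<And>f. ((\<lambda>n. x n f) \<longlongrightarrow> \<phi> f) F"
proof -
  let ?U = "PiE UNIV (\<lambda>f. {- K f..K f})"
  have "compactin (product_topology (\<lambda>_. euclidean) UNIV) ?U"
    by (subst compactin_PiE) (simp add: compactin_euclidean_iff)
  then have "compact ?U"
    by (simp add: euclidean_product_topology compactin_euclidean_iff)
  moreover have "filtermap x sequentially \<noteq> bot"
    by (simp add: filtermap_bot_iff)
  moreover have "eventually (\<lambda>y. y \<in> ?U) (filtermap x sequentially)"
    unfolding eventually_filtermap
    by (intro always_eventually allI PiE_I) (use assms in \<open>auto simp: abs_le_iff minus_le_iff\<close>)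
  ultimately obtain \<phi> where \<phi>: "inf (nhds \<phi>) (filtermap x sequentially) \<noteq> bot"
    unfolding compact_filter by blast
  let ?F = "inf sequentially (filtercomap x (nhds \<phi>))"
  have "?F \<noteq> bot"
  proof
    assume "?F = bot"
    then obtain P Q where "eventually P sequentially" "eventually Q (nhds \<phi>)" "\<And>n. P n \<Longrightarrow> \<not> Q (x n)"
      unfolding trivial_limit_def eventually_inf eventually_filtercomap by blast
    then have "eventually (\<lambda>y. \<not> Q y) (filtermap x sequentially)" "eventually Q (nhds \<phi>)"
      by (auto simp: eventually_filtermap elim: eventually_mono)
    then have "eventually (\<lambda>_. False) (inf (nhds \<phi>) (filtermap x sequentially))"
      unfolding eventually_inf by blast
    with \<phi> show False by (simp add: trivial_limit_def)
  qed
  moreover have "((\<lambda>n. x n f) \<longlongrightarrow> \<phi> f) ?F" for f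
  proof -
    have "filterlim x (nhds \<phi>) ?F"
      by (metis filterlim_filtercomap filterlim_mono inf.cobounded2 order_refl)
    moreover have "open ((\<lambda>y. y f) -` V :: ('b \<Rightarrow> real) set)" if "open V" for V
      using that continuous_on_product_coordinates by (rule open_vimage)
    ultimately show ?thesis
      by (intro topological_tendstoI) (force dest: topological_tendstoD)
  qed
  ultimately show ?thesis using that by (metis inf.cobounded1)
qed

lemma linear_funpow_blinfun:
  fixes S :: "'a::real_normed_vector \<Rightarrow>\<^sub>L 'a"
  shows "linear (blinfun_apply S ^^ k)"
proof (induction k)
  case 0
  then show ?case by (simp add: linear_iff)
next
  case (Suc k)
  then show ?case by (auto simp: linear_iff blinfun.bilinear_simps)
qed

lemma positive_funpow:
  fixes S :: "'a::{real_normed_vector,ord} \<Rightarrow>\<^sub>L 'a"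
  assumes "positive_op S" "0 \<le> f"
  shows "0 \<le> (blinfun_apply S ^^ k) f"
  using assms by (induction k) (auto simp: positive_op_def)

text \<open>
  The functional is a cluster point of the Cesaro means of \<open>mass\<close> along the orbits of \<open>S\<close>. Bounds valid
  for every power of \<open>S\<close> survive averaging and the limit. Invariance holds because replacing \<open>f\<close> by \<open>S f\<close>
  telescopes in the mean and changes it only by \<open>O (1 / n)\<close>.
\<close>

lemma invariant_functional_exists:
  fixes S :: "'a::al_space \<Rightarrow>\<^sub>L 'a"
  assumes pos: "positive_op S" and "0 \<le> c"
    and upper: "\<And>k f. norm ((blinfun_apply S ^^ k) f) \<le> M * norm f"
    and lower: "\<And>k f. 0 \<le> f \<Longrightarrow> c * norm f \<le> norm ((blinfun_apply S ^^ k) f)"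
  obtains \<phi> :: "'a \<Rightarrow>\<^sub>L real" where "\<And>f. \<phi> (S f) = \<phi> f"
    "\<And>f. 0 \<le> f \<Longrightarrow> c * norm f \<le> \<phi> f" "\<And>f. \<bar>\<phi> f\<bar> \<le> M * norm f"
proof -
  define x where "x n f = (\<Sum>k<Suc n. mass ((blinfun_apply S ^^ k) f)) / Suc n" for n f
  have mass_le: "\<bar>mass ((blinfun_apply S ^^ k) f)\<bar> \<le> M * norm f" for k f
    using abs_mass_le upper order_trans by blast
  have x_le: "\<bar>x n f\<bar> \<le> M * norm f" for n f
  proof -
    have "\<bar>\<Sum>k<Suc n. mass ((blinfun_apply S ^^ k) f)\<bar> \<le> (\<Sum>k<Suc n. M * norm f)"
      by (rule order_trans[OF sum_abs sum_mono]) (rule mass_le)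
    then show ?thesis by (simp add: x_def field_simps)
  qed
  then obtain F \<phi> where F: "F \<noteq> bot" "F \<le> sequentially"
    and lim: "\<And>f. ((\<lambda>n. x n f) \<longlongrightarrow> \<phi> f) F"
    using pointwise_cluster_function[of x "\<lambda>f. M * norm f"] by blast
  have lin: "linear (\<lambda>f. mass ((blinfun_apply S ^^ k) f))" for k
    using linear_compose[OF linear_funpow_blinfun linear_mass] by (simp add: o_def)
  have x_add: "x n (f + g) = x n f + x n g" for n f g
    by (simp add: x_def linear_add[OF lin] sum.distrib add_divide_distrib del: sum.lessThan_Suc)
  have x_scale: "x n (r *\<^sub>R f) = r * x n f" for n f r
    by (simp add: x_def linear_cmul[OF lin] sum_distrib_left del: sum.lessThan_Suc)
  have "\<phi> (f + g) = \<phi> f + \<phi> g" for f g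
    using tendsto_unique[OF F(1) lim[of "f + g"]] tendsto_add[OF lim lim] by (simp add: x_add)
  moreover have "\<phi> (r *\<^sub>R f) = r *\<^sub>R \<phi> f" for r f
    using tendsto_unique[OF F(1) lim[of "r *\<^sub>R f"]] tendsto_mult_left[OF lim, of r f] by (simp add: x_scale)
  moreover have bound: "\<bar>\<phi> f\<bar> \<le> M * norm f" for f
    by (rule tendsto_upperbound[OF tendsto_rabs[OF lim]]) (simp_all add: x_le F(1))
  ultimately have "bounded_linear \<phi>"
    by (intro bounded_linear_intro[where K = M]) (simp_all add: mult.commute)
  then have apply_\<phi>: "blinfun_apply (Blinfun \<phi>) = \<phi>"
    by (rule bounded_linear_Blinfun_apply)
  have "\<phi> (S f) = \<phi> f" for f
  proof -
    have diff: "x n (S f) - x n f = (mass ((blinfun_apply S ^^ Suc n) f) - mass f) / Suc n" for n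
    proof -
      have "x n (S f) - x n f = (\<Sum>k<Suc n. mass ((blinfun_apply S ^^ Suc k) f) - mass ((blinfun_apply S ^^ k) f)) / Suc n"
        by (simp only: x_def sum_subtractf diff_divide_distrib funpow_Suc_right o_apply)
      then show ?thesis by (simp only: sum_lessThan_telescope[of "\<lambda>k. mass ((blinfun_apply S ^^ k) f)" "Suc n"] funpow_0)
    qed
    have "(\<lambda>n. x n (S f) - x n f) \<longlonglongrightarrow> 0"
    proof (rule Lim_null_comparison)
      show "(\<lambda>n. (2 * M * norm f) / Suc n) \<longlonglongrightarrow> 0"
        by (rule LIMSEQ_Suc[OF lim_const_over_n])
      show "\<forall>\<^sub>F n in sequentially. norm (x n (S f) - x n f) \<le> (2 * M * norm f) / Suc n"
      proof (rule always_eventually, rule allI)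
        fix n
        have "\<bar>mass ((blinfun_apply S ^^ Suc n) f) - mass f\<bar> \<le> 2 * M * norm f"
          using mass_le[of "Suc n" f] mass_le[of 0 f] unfolding funpow_0 by linarith
        then show "norm (x n (S f) - x n f) \<le> (2 * M * norm f) / Suc n"
          unfolding diff by (simp add: divide_right_mono)
      qed
    qed
    then have "((\<lambda>n. x n (S f) - x n f) \<longlongrightarrow> 0) F"
      using F(2) tendsto_mono by blast
    then show ?thesis
      using tendsto_unique[OF F(1) _ tendsto_diff[OF lim[of "S f"] lim[of f]]] by fastforce
  qed
  moreover have "c * norm f \<le> \<phi> f" if "0 \<le> f" for f
  proof -
    have "c * norm f \<le> x n f" for n
    proof -
      have "(\<Sum>k<Suc n. c * norm f) \<le> (\<Sum>k<Suc n. mass ((blinfun_apply S ^^ k) f))"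
        by (rule sum_mono) (simp add: mass_nonneg_eq positive_funpow[OF pos that] lower that)
      then show ?thesis by (simp add: x_def field_simps)
    qed
    then show ?thesis
      using tendsto_lowerbound[OF lim _ F(1)] by simp
  qed
  ultimately show ?thesis
    using that[of "Blinfun \<phi>"] bound by (simp add: apply_\<phi>)
qed

section \<open>Powers of a single operator dominating a fixed vector\<close>

text \<open>
  If \<open>\<phi> g = 0\<close>, the positive and the negative part of \<open>g\<close> have the same mass \<open>m\<close>, so each has norm at least
  \<open>m / M\<close>, and the image of each dominates \<open>(m / M) h\<close> up to a small error. This common part cancels in \<open>S g\<close>
  and thus lowers \<open>\<phi> \<bar>S g\<bar>\<close> by \<open>2 (m / M) \<phi> h\<close> against the value \<open>2 m = \<phi> \<bar>g\<bar>\<close>. The two errors together cost at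
  most \<open>4 M \<delta> m / c\<close>.
\<close>

lemma contraction_on_kernel:
  fixes S :: "'a::al_space \<Rightarrow>\<^sub>L 'a" and \<phi> :: "'a \<Rightarrow>\<^sub>L real"
  assumes invariant: "\<And>f. \<phi> (S f) = \<phi> f"
    and "0 < c" "0 < M" "0 \<le> \<delta>" "0 \<le> h"
    and lower: "\<And>f. 0 \<le> f \<Longrightarrow> c * norm f \<le> \<phi> f"
    and upper: "\<And>f. 0 \<le> f \<Longrightarrow> \<phi> f \<le> M * norm f"
    and dominates: "\<And>f. 0 \<le> f \<Longrightarrow> \<exists>e\<ge>0. norm e \<le> \<delta> * norm f \<and> norm f *\<^sub>R h \<le> S f + e"
    and "\<phi> g = 0"
  shows "\<phi> \<bar>S g\<bar> \<le> (1 - \<phi> h / M + 2 * M * \<delta> / c) * \<phi> \<bar>g\<bar>"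
proof -
  define m where "m = \<phi> (pprt g)"
  have mono: "\<phi> a \<le> \<phi> b" if "a \<le> b" for a b
  proof -
    have "0 \<le> c * norm (b - a)" using \<open>0 < c\<close> by simp
    also have "\<dots> \<le> \<phi> (b - a)" using that by (intro lower) simp
    finally show ?thesis by (simp add: blinfun.diff_right)
  qed
  have "\<phi> g = \<phi> (pprt g) - \<phi> (pprt (- g))"
    by (metis parts_diff blinfun.diff_right)
  then have m': "\<phi> (pprt (- g)) = m" using \<open>\<phi> g = 0\<close> by (simp add: m_def)
  have abs_g: "\<phi> \<bar>g\<bar> = 2 * m"
    by (simp add: abs_parts[symmetric] blinfun.add_right m' m_def)
  have part: "\<exists>e\<ge>0. \<phi> e \<le> M * \<delta> * m / c \<and> (m / M) *\<^sub>R h \<le> S f + e" if f: "0 \<le> f" "\<phi> f = m" for f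
  proof -
    obtain e where e: "0 \<le> e" "norm e \<le> \<delta> * norm f" "norm f *\<^sub>R h \<le> S f + e"
      using dominates[OF f(1)] by blast
    have "norm f \<le> m / c" using lower[OF f(1)] \<open>0 < c\<close> by (simp add: f(2) field_simps)
    then have "M * (\<delta> * norm f) \<le> M * (\<delta> * (m / c))"
      using \<open>0 < M\<close> \<open>0 \<le> \<delta>\<close> by (intro mult_left_mono) auto
    moreover have "\<phi> e \<le> M * (\<delta> * norm f)"
      using upper[OF e(1)] e(2) \<open>0 < M\<close> by (meson mult_left_mono order_trans less_imp_le)
    ultimately have "\<phi> e \<le> M * \<delta> * m / c" by simp
    moreover have "m / M \<le> norm f"
      using upper[OF f(1)] \<open>0 < M\<close> by (simp add: f(2) field_simps)
    then have "(m / M) *\<^sub>R h \<le> S f + e"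
      using e(3) scaleR_right_mono[OF _ \<open>0 \<le> h\<close>] order_trans by blast
    ultimately show ?thesis using e(1) by blast
  qed
  obtain e1 where e1: "0 \<le> e1" "\<phi> e1 \<le> M * \<delta> * m / c" "(m / M) *\<^sub>R h \<le> S (pprt g) + e1"
    using part[of "pprt g"] m_def by auto
  obtain e2 where e2: "0 \<le> e2" "\<phi> e2 \<le> M * \<delta> * m / c" "(m / M) *\<^sub>R h \<le> S (pprt (- g)) + e2"
    using part[of "pprt (- g)"] m' by auto
  \<comment> \<open>What remains of the two images after the common part is removed; the errors make both positive.\<close>
  let ?u = "S (pprt g) + e1 - (m / M) *\<^sub>R h" and ?v = "S (pprt (- g)) + e2 - (m / M) *\<^sub>R h"
  have "S g = S (pprt g) - S (pprt (- g))"
    by (metis parts_diff blinfun.diff_right)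
  then have "S g = (?u + e2) - (?v + e1)"
    by simp
  then have "\<bar>S g\<bar> \<le> \<bar>?u + e2\<bar> + \<bar>?v + e1\<bar>"
    using abs_triangle_ineq4 by metis
  also have "\<dots> = (?u + e2) + (?v + e1)"
    using e1 e2 by (simp add: add_nonneg_nonneg)
  finally have "\<phi> \<bar>S g\<bar> \<le> \<phi> ((?u + e2) + (?v + e1))" by (rule mono)
  also have "\<dots> = 2 * m + 2 * \<phi> e1 + 2 * \<phi> e2 - 2 * ((m / M) * \<phi> h)"
    by (simp add: blinfun.bilinear_simps invariant m' m_def)
  also have "\<dots> \<le> 2 * m + 4 * (M * \<delta> * m / c) - 2 * ((m / M) * \<phi> h)"
    using e1(2) e2(2) by linarith
  also have "\<dots> = (1 - \<phi> h / M + 2 * M * \<delta> / c) * \<phi> \<bar>g\<bar>"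
    by (simp add: abs_g algebra_simps)
  finally show ?thesis .
qed

text \<open>
  The error constant is chosen so that the error term of the contraction factor is half of the lower bound
  \<open>c \<parallel>h\<parallel> / M\<close> for the gain \<open>\<phi> h / M\<close>, which leaves the factor \<open>q = 1 - c \<parallel>h\<parallel> / (2 M)\<close>. The assumptions
  \<open>c \<le> 1\<close> and \<open>norm h \<le> M\<close> make \<open>q\<close> nonnegative. Differences along an orbit lie in the kernel of \<open>\<phi>\<close>; so
  the orbit of a positive vector of mass one is Cauchy, and its limit is the fixed vector.
\<close>

lemma powers_converge_to_rank_one:
  fixes S :: "'a::al_space \<Rightarrow>\<^sub>L 'a"
  assumes pos: "positive_op S" and c: "0 < c" "c \<le> 1" and M: "1 \<le> M" and h: "0 < h" "norm h \<le> M"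
    and upper: "\<And>k f. norm ((blinfun_apply S ^^ k) f) \<le> M * norm f"
    and lower: "\<And>k f. 0 \<le> f \<Longrightarrow> c * norm f \<le> norm ((blinfun_apply S ^^ k) f)"
    and dominates: "\<And>f. 0 \<le> f \<Longrightarrow>
      \<exists>e\<ge>0. norm e \<le> c\<^sup>2 * norm h / (4 * M\<^sup>2) * norm f \<and> norm f *\<^sub>R h \<le> S f + e"
  obtains f0 and \<phi> :: "'a \<Rightarrow>\<^sub>L real" and \<epsilon> C q where "0 \<le> f0" "norm f0 = 1"
    "\<phi> f0 = 1" "0 < \<epsilon>" "\<And>f. 0 \<le> f \<Longrightarrow> \<epsilon> * norm f \<le> \<phi> f"
    "0 \<le> q" "q < 1" "\<And>k f. norm ((blinfun_apply S ^^ k) f - \<phi> f *\<^sub>R f0) \<le> C * q ^ k * norm f"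
proof -
  obtain \<phi> :: "'a \<Rightarrow>\<^sub>L real" where invariant: "\<And>f. \<phi> (S f) = \<phi> f"
    and \<phi>_lower: "\<And>f. 0 \<le> f \<Longrightarrow> c * norm f \<le> \<phi> f" and \<phi>_upper: "\<And>f. \<bar>\<phi> f\<bar> \<le> M * norm f"
    using invariant_functional_exists[OF pos _ upper lower] c by (metis less_imp_le)
  have invariant': "\<phi> ((blinfun_apply S ^^ k) f) = \<phi> f" for k f
    by (induction k) (simp_all add: invariant)
  define q where "q = 1 - c * norm h / (2 * M)"
  have "c * norm h \<le> 1 * M" using c h by (intro mult_mono) auto
  moreover have "0 < c * norm h" using c h by auto
  ultimately have q: "0 \<le> q" "q < 1" using M by (auto simp: q_def field_simps)
  have step: "\<phi> \<bar>S g\<bar> \<le> q * \<phi> \<bar>g\<bar>" if "\<phi> g = 0" for g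
  proof -
    let ?\<delta> = "c\<^sup>2 * norm h / (4 * M\<^sup>2)"
    have up: "\<phi> f \<le> M * norm f" for f using \<phi>_upper[of f] by simp
    have "\<phi> \<bar>S g\<bar> \<le> (1 - \<phi> h / M + 2 * M * ?\<delta> / c) * \<phi> \<bar>g\<bar>"
      by (rule contraction_on_kernel[OF invariant _ _ _ _ \<phi>_lower up dominates that])
         (use c M h in \<open>auto simp: less_imp_le\<close>)
    also have "\<dots> \<le> q * \<phi> \<bar>g\<bar>"
    proof (rule mult_right_mono)
      have "c * norm h / M \<le> \<phi> h / M"
        using \<phi>_lower[of h] h M by (simp add: divide_right_mono)
      moreover have eq: "2 * M * ?\<delta> / c = c * norm h / (2 * M)"
        using c M by (simp add: power2_eq_square)
      moreover have "c * norm h / (2 * M) = c * norm h / M / 2" by simp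
      ultimately show "1 - \<phi> h / M + 2 * M * ?\<delta> / c \<le> q"
        unfolding q_def eq by linarith
      have "0 \<le> c * norm \<bar>g\<bar>" using c by simp
      also have "\<dots> \<le> \<phi> \<bar>g\<bar>" by (rule \<phi>_lower) simp
      finally show "0 \<le> \<phi> \<bar>g\<bar>" .
    qed
    finally show ?thesis .
  qed
  have kernel: "norm ((blinfun_apply S ^^ k) g) \<le> M / c * q ^ k * norm g" if "\<phi> g = 0" for g k
  proof -
    have "\<phi> \<bar>(blinfun_apply S ^^ k) g\<bar> \<le> q ^ k * \<phi> \<bar>g\<bar>"
    proof (induction k)
      case (Suc k)
      have "\<phi> \<bar>(blinfun_apply S ^^ Suc k) g\<bar> \<le> q * \<phi> \<bar>(blinfun_apply S ^^ k) g\<bar>"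
        using step[of "(blinfun_apply S ^^ k) g"] that by (simp add: invariant')
      also have "\<dots> \<le> q * (q ^ k * \<phi> \<bar>g\<bar>)"
        using Suc q(1) by (rule mult_left_mono)
      finally show ?case by simp
    qed simp
    also have "\<dots> \<le> q ^ k * (M * norm g)"
      using \<phi>_upper[of "\<bar>g\<bar>"] q by (intro mult_left_mono) (simp_all add: norm_abs_eq)
    finally have "c * norm \<bar>(blinfun_apply S ^^ k) g\<bar> \<le> q ^ k * (M * norm g)"
      using \<phi>_lower[of "\<bar>(blinfun_apply S ^^ k) g\<bar>"] by simp
    then show ?thesis using c by (simp add: norm_abs_eq field_simps)
  qed
  define w where "w = (1 / \<phi> h) *\<^sub>R h"
  have "0 < \<phi> h" using \<open>0 < c * norm h\<close> \<phi>_lower[OF less_imp_le[OF h(1)]] by linarith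
  then have w: "0 \<le> w" "\<phi> w = 1"
    using h by (simp_all add: w_def blinfun.scaleR_right scaleR_nonneg_nonneg)
  have "Cauchy (\<lambda>k. (blinfun_apply S ^^ k) w)"
  proof (rule metric_CauchyI)
    fix e :: real
    assume "0 < e"
    let ?C = "M / c * (norm w + M * norm w)"
    have "(\<lambda>k. ?C * q ^ k) \<longlonglongrightarrow> 0"
      using q by (intro tendsto_mult_right_zero LIMSEQ_realpow_zero)
    then have "\<forall>\<^sub>F k in sequentially. ?C * q ^ k < e / 2"
      using \<open>0 < e\<close> by (intro order_tendstoD(2)) auto
    then obtain N where N: "?C * q ^ N < e / 2"
      unfolding eventually_sequentially by blast
    have near: "dist ((blinfun_apply S ^^ k) w) ((blinfun_apply S ^^ N) w) < e / 2" if k: "N \<le> k" for k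
    proof -
      obtain j where j: "k = N + j" using le_Suc_ex[OF k] by blast
      have "dist ((blinfun_apply S ^^ k) w) ((blinfun_apply S ^^ N) w)
          = norm ((blinfun_apply S ^^ N) ((blinfun_apply S ^^ j) w - w))"
        by (simp add: dist_norm j funpow_add linear_diff[OF linear_funpow_blinfun])
      also have "\<dots> \<le> M / c * q ^ N * norm ((blinfun_apply S ^^ j) w - w)"
        by (rule kernel) (simp add: blinfun.diff_right invariant')
      also have "\<dots> \<le> M / c * q ^ N * (norm w + M * norm w)"
      proof (rule mult_left_mono)
        show "norm ((blinfun_apply S ^^ j) w - w) \<le> norm w + M * norm w"
          using norm_triangle_ineq4[of "(blinfun_apply S ^^ j) w" w] upper[of j w] by linarith
      qed (use c M q in simp)
      also have "\<dots> = ?C * q ^ N" by simp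
      finally show ?thesis using N by linarith
    qed
    show "\<exists>N. \<forall>m\<ge>N. \<forall>n\<ge>N. dist ((blinfun_apply S ^^ m) w) ((blinfun_apply S ^^ n) w) < e"
      using near dist_triangle_half_l by blast
  qed
  then obtain f1 where f1: "(\<lambda>k. (blinfun_apply S ^^ k) w) \<longlonglongrightarrow> f1"
    using Cauchy_convergent convergent_def by blast
  have "0 \<le> f1" by (rule nonneg_limit[OF f1]) (rule positive_funpow[OF pos w(1)])
  have "(\<lambda>k. \<phi> ((blinfun_apply S ^^ k) w)) \<longlonglongrightarrow> \<phi> f1"
    using f1 by (intro tendsto_intros)
  then have \<phi>_f1: "\<phi> f1 = 1" by (simp add: invariant' w LIMSEQ_const_iff)
  then have "f1 \<noteq> 0" by auto
  have "(\<lambda>k. S ((blinfun_apply S ^^ k) w)) \<longlonglongrightarrow> S f1"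
    using f1 by (intro tendsto_intros)
  then have "S f1 = f1"
    using LIMSEQ_Suc[OF f1] LIMSEQ_unique by fastforce
  then have f1_fixed: "(blinfun_apply S ^^ k) f1 = f1" for k
    by (induction k) simp_all
  let ?C = "M / c * (1 + M * norm f1)"
  have bound: "norm ((blinfun_apply S ^^ k) f - \<phi> f *\<^sub>R f1) \<le> ?C * q ^ k * norm f" for k f
  proof -
    have "(blinfun_apply S ^^ k) f - \<phi> f *\<^sub>R f1 = (blinfun_apply S ^^ k) (f - \<phi> f *\<^sub>R f1)"
      by (simp add: linear_diff[OF linear_funpow_blinfun] linear_cmul[OF linear_funpow_blinfun] f1_fixed)
    then have "norm ((blinfun_apply S ^^ k) f - \<phi> f *\<^sub>R f1) \<le> M / c * q ^ k * norm (f - \<phi> f *\<^sub>R f1)"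
      using kernel[of "f - \<phi> f *\<^sub>R f1" k] by (simp add: blinfun.bilinear_simps \<phi>_f1)
    also have "\<dots> \<le> M / c * q ^ k * (norm f + M * norm f * norm f1)"
    proof (rule mult_left_mono)
      have "norm (f - \<phi> f *\<^sub>R f1) \<le> norm f + \<bar>\<phi> f\<bar> * norm f1"
        using norm_triangle_ineq4[of f "\<phi> f *\<^sub>R f1"] by simp
      also have "\<dots> \<le> norm f + M * norm f * norm f1"
        by (intro add_left_mono mult_right_mono \<phi>_upper) simp
      finally show "norm (f - \<phi> f *\<^sub>R f1) \<le> norm f + M * norm f * norm f1" .
    qed (use c M q in simp)
    also have "\<dots> = ?C * q ^ k * norm f" by (simp add: algebra_simps)
    finally show ?thesis .
  qed
  \<comment> \<open>Normalising the vector is compensated in the functional, so the projection stays the same.\<close>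
  show ?thesis
  proof (rule that[of "(1 / norm f1) *\<^sub>R f1" "norm f1 *\<^sub>R \<phi>" "norm f1 * c" q ?C])
    show "norm f1 * c * norm f \<le> (norm f1 *\<^sub>R \<phi>) f" if "0 \<le> f" for f
      using mult_left_mono[OF \<phi>_lower[OF that], of "norm f1"] by (simp add: blinfun.scaleR_left mult.assoc)
    show "norm ((blinfun_apply S ^^ k) f - (norm f1 *\<^sub>R \<phi>) f *\<^sub>R ((1 / norm f1) *\<^sub>R f1)) \<le> ?C * q ^ k * norm f" for k f
      using bound[of k f] \<open>f1 \<noteq> 0\<close> by (simp add: blinfun.scaleR_left)
  qed (use \<open>0 \<le> f1\<close> \<open>f1 \<noteq> 0\<close> c q \<phi>_f1 in \<open>auto simp: blinfun.bilinear_simps scaleR_nonneg_nonneg\<close>)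
qed

section \<open>Transfer to the semigroup\<close>

lemma semigroup_multiple:
  assumes sg: "op_semigroup J T" and t: "t \<in> J" and add: "\<And>s t. s \<in> J \<Longrightarrow> t \<in> J \<Longrightarrow> s + t \<in> J"
  shows "real (Suc k) * t \<in> J \<and> blinfun_apply (T (real (Suc k) * t)) = blinfun_apply (T t) ^^ Suc k"
proof (induction k)
  case 0
  then show ?case using t by simp
next
  case (Suc k)
  have eq: "real (Suc (Suc k)) * t = t + real (Suc k) * t" by (simp add: algebra_simps)
  show ?case
    unfolding eq using Suc t add sg unfolding op_semigroup_def
    by (auto simp: fun_eq_iff)
qed

lemma bounded_powers_eq_one:
  fixes l :: real
  assumes "0 \<le> l" "0 < c" and bounds: "\<And>n. N \<le> n \<Longrightarrow> c \<le> l ^ n \<and> l ^ n \<le> M"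
  shows "l = 1"
proof (rule ccontr)
  assume "l \<noteq> 1"
  then consider "l < 1" | "1 < l" by linarith
  then show False
  proof cases
    case 1
    then obtain n where "l ^ n < c" using real_arch_pow_inv[OF \<open>0 < c\<close>] by blast
    moreover have "l ^ (n + N) \<le> l ^ n" using 1 \<open>0 \<le> l\<close> by (intro power_decreasing) auto
    ultimately show False using bounds[of "n + N"] by simp
  next
    case 2
    then obtain n where "M < l ^ n" using real_arch_pow by blast
    moreover have "l ^ n \<le> l ^ (n + N)" using 2 by (intro power_increasing) auto
    ultimately show False using bounds[of "n + N"] by simp
  qed
qed

lemma rank_one_limit_imp_lower_bound:
  fixes T :: "real \<Rightarrow> 'a::al_space \<Rightarrow>\<^sub>L 'a"
  assumes f0: "0 \<le> f0" "norm f0 = 1" and "0 < \<epsilon>"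
    and \<epsilon>: "\<And>f. 0 \<le> f \<Longrightarrow> norm f = 1 \<Longrightarrow> \<epsilon> \<le> blinfun_apply \<phi> f"
    and lim: "(T \<longlongrightarrow> rank_one \<phi> f0) F"
  shows "\<exists>h>0. ((\<lambda>t. SUP f\<in>{f. 0 \<le> f \<and> norm f = 1}. norm (neg_part (T t f - h))) \<longlongrightarrow> 0) F"
proof (intro exI conjI)
  have "f0 \<noteq> 0" using f0 by auto
  then show "0 < \<epsilon> *\<^sub>R f0"
    using f0 \<open>0 < \<epsilon>\<close> by (simp add: less_le scaleR_nonneg_nonneg)
  let ?D = "{f :: 'a. 0 \<le> f \<and> norm f = 1}"
  have le: "norm (neg_part (T t f - \<epsilon> *\<^sub>R f0)) \<le> norm (T t - rank_one \<phi> f0)" if "f \<in> ?D" for t f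
  proof -
    have "0 \<le> (blinfun_apply \<phi> f - \<epsilon>) *\<^sub>R f0"
      using \<epsilon> that f0 by (intro scaleR_nonneg_nonneg) auto
    then have "norm (neg_part (T t f - \<epsilon> *\<^sub>R f0))
        \<le> norm (T t f - \<epsilon> *\<^sub>R f0 - (blinfun_apply \<phi> f - \<epsilon>) *\<^sub>R f0)"
      by (rule norm_neg_part_le)
    also have "\<dots> = norm ((T t - rank_one \<phi> f0) f)"
      by (simp add: blinfun.diff_left algebra_simps)
    also have "\<dots> \<le> norm (T t - rank_one \<phi> f0)"
      using norm_blinfun[of "T t - rank_one \<phi> f0" f] that by simp
    finally show ?thesis .
  qed
  have f0_D: "f0 \<in> ?D" using f0 by simp
  show "((\<lambda>t. SUP f\<in>?D. norm (neg_part (T t f - \<epsilon> *\<^sub>R f0))) \<longlongrightarrow> 0) F"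
  proof (rule tendsto_sandwich[OF _ _ tendsto_const])
    show "((\<lambda>t. norm (T t - rank_one \<phi> f0)) \<longlongrightarrow> 0) F"
      using lim by (simp add: tendsto_norm_zero_iff Lim_null[symmetric])
    show "\<forall>\<^sub>F t in F. (SUP f\<in>?D. norm (neg_part (T t f - \<epsilon> *\<^sub>R f0))) \<le> norm (T t - rank_one \<phi> f0)"
      by (intro always_eventually allI cSUP_least) (use f0_D le in auto)
    show "\<forall>\<^sub>F t in F. 0 \<le> (SUP f\<in>?D. norm (neg_part (T t f - \<epsilon> *\<^sub>R f0)))"
      by (intro always_eventually allI cSUP_upper2[OF _ f0_D] bdd_aboveI2[where M = "norm (T _ - rank_one \<phi> f0)"])
        (use le in auto)
  qed
qed

text \<open>
  The uniform bound on the unit sphere in homogeneous form. An existential error vector spares any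
  computation with the negative part.
\<close>

lemma lower_bound_error:
  fixes A :: "'a::al_space \<Rightarrow>\<^sub>L 'a"
  assumes pos: "positive_op A" and f: "0 \<le> f" and "0 \<le> h"
    and sup: "(SUP f\<in>{f. 0 \<le> f \<and> norm f = 1}. norm (neg_part (A f - h))) \<le> \<delta>"
  shows "\<exists>e\<ge>0. norm e \<le> \<delta> * norm f \<and> norm f *\<^sub>R h \<le> A f + e"
proof (cases "f = 0")
  case True
  then show ?thesis by (intro exI[of _ 0]) simp
next
  case False
  define u where "u = (1 / norm f) *\<^sub>R f"
  have u: "0 \<le> u" "norm u = 1" and f_eq: "f = norm f *\<^sub>R u"
    using f False by (auto simp: u_def scaleR_nonneg_nonneg)
  have "bdd_above ((\<lambda>f. norm (neg_part (A f - h))) ` {f. 0 \<le> f \<and> norm f = 1})"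
  proof (rule bdd_aboveI2)
    fix g :: 'a
    assume "g \<in> {f. 0 \<le> f \<and> norm f = 1}"
    then have "0 \<le> A g" using pos by (simp add: positive_op_def)
    from norm_neg_part_le[OF this, of "A g - h"] show "norm (neg_part (A g - h)) \<le> norm h" by simp
  qed
  then have e: "norm (neg_part (A u - h)) \<le> \<delta>"
    using cSUP_upper[of u "{f. 0 \<le> f \<and> norm f = 1}"] u sup by fastforce
  let ?e = "norm f *\<^sub>R neg_part (A u - h)"
  have "h \<le> A u + neg_part (A u - h)"
    using add_left_mono[OF add_neg_part_nonneg[of "A u - h"], of h] by simp
  then have "norm f *\<^sub>R h \<le> norm f *\<^sub>R A u + ?e"
    by (metis norm_ge_zero scaleR_left_mono scaleR_right_distrib)
  also have "norm f *\<^sub>R A u = A f"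
    by (subst (2) f_eq) (simp add: blinfun.scaleR_right)
  finally have "norm f *\<^sub>R h \<le> A f + ?e" .
  moreover have "norm ?e \<le> \<delta> * norm f"
    using mult_right_mono[OF e, of "norm f"] by (simp add: mult.commute)
  moreover have "0 \<le> ?e" by (simp add: scaleR_nonneg_nonneg neg_part_nonneg)
  ultimately show ?thesis by blast
qed

lemma norm_lower_bound:
  fixes A :: "'a::al_space \<Rightarrow>\<^sub>L 'a"
  assumes pos: "positive_op A" and f: "0 \<le> f" and "0 \<le> h"
    and e: "\<exists>e\<ge>0. norm e \<le> norm h / 2 * norm f \<and> norm f *\<^sub>R h \<le> A f + e"
  shows "norm h / 2 * norm f \<le> norm (A f)"
proof -
  obtain e where "norm e \<le> norm h / 2 * norm f" "norm f *\<^sub>R h \<le> A f + e"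
    using e by blast
  moreover from this have "norm (norm f *\<^sub>R h) \<le> norm (A f + e)"
    using \<open>0 \<le> h\<close> by (intro norm_mono_nonneg) (simp_all add: scaleR_nonneg_nonneg)
  ultimately show ?thesis
    using norm_triangle_ineq[of "A f" e] by (simp add: mult.commute)
qed

text \<open>
  Only the additive structure of the time set enters: it consists of positive reals, is unbounded, and is
  closed under addition and under positive differences.
\<close>

lemma lower_bound_imp_rank_one_limit:
  fixes J :: "real set" and T :: "real \<Rightarrow> 'a::al_space \<Rightarrow>\<^sub>L 'a"
  assumes unbounded: "\<And>b. \<exists>t\<in>J. b \<le> t" and J_pos: "\<And>t. t \<in> J \<Longrightarrow> 0 < t"
    and add: "\<And>s t. s \<in> J \<Longrightarrow> t \<in> J \<Longrightarrow> s + t \<in> J"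
    and diff: "\<And>s t. s \<in> J \<Longrightarrow> t \<in> J \<Longrightarrow> s < t \<Longrightarrow> t - s \<in> J"
    and bdd: "bounded_semigroup J T" and pos: "positive_semigroup J T"
    and "0 < h"
    and lim: "((\<lambda>t. SUP f\<in>{f. 0 \<le> f \<and> norm f = 1}. norm (neg_part (T t f - h))) \<longlongrightarrow> 0) (at_top_in J)"
  obtains f0 \<phi> \<epsilon> where "0 \<le> f0" "norm f0 = 1" "fixed_vector J T f0" "positive_op \<phi>"
    "fixed_functional J T \<phi>" "blinfun_apply \<phi> f0 = 1" "0 < \<epsilon>"
    "\<And>f. 0 \<le> f \<Longrightarrow> \<epsilon> * norm f \<le> blinfun_apply \<phi> f" "(T \<longlongrightarrow> rank_one \<phi> f0) (at_top_in J)"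
proof -
  have sg: "op_semigroup J T" using bdd by (simp add: bounded_semigroup_def)
  have comp: "T (s + t) f = T s (T t f)" if "s \<in> J" "t \<in> J" for s t f
    using sg that by (simp add: op_semigroup_def)
  have pos_T: "positive_op (T t)" if "t \<in> J" for t
    using pos that by (simp add: positive_semigroup_def)
  obtain B where B: "\<And>t. t \<in> J \<Longrightarrow> norm (T t) \<le> B"
    using bdd by (auto simp: bounded_semigroup_def bdd_above_def)
  define M where "M = max 1 (max B (norm h))"
  have M: "1 \<le> M" "norm h \<le> M" by (auto simp: M_def)
  have T_upper: "norm (T t f) \<le> M * norm f" if "t \<in> J" for t f
  proof -
    have "norm (T t f) \<le> norm (T t) * norm f" by (rule norm_blinfun)
    also have "\<dots> \<le> M * norm f" using B[OF that] by (intro mult_right_mono) (auto simp: M_def)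
    finally show ?thesis .
  qed
  define c where "c = min 1 (norm h / 2)"
  have "h \<noteq> 0" "0 \<le> h" using \<open>0 < h\<close> by auto
  then have c: "0 < c" "c \<le> 1" by (auto simp: c_def)
  define \<delta> where "\<delta> = c\<^sup>2 * norm h / (4 * M\<^sup>2)"
  have "0 < min \<delta> (norm h / 2)"
    using c M \<open>h \<noteq> 0\<close> by (simp add: \<delta>_def)
  from order_tendstoD(2)[OF lim this] obtain t1 where t1: "\<And>t. t \<in> J \<Longrightarrow> t1 \<le> t \<Longrightarrow>
      (SUP f\<in>{f. 0 \<le> f \<and> norm f = 1}. norm (neg_part (T t f - h))) < min \<delta> (norm h / 2)"
    unfolding eventually_at_top_in by blast
  have T_lower: "c * norm f \<le> norm (T t f)" if "t \<in> J" "t1 \<le> t" "0 \<le> f" for t f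
  proof -
    have "c * norm f \<le> norm h / 2 * norm f" by (intro mult_right_mono) (auto simp: c_def)
    also have "\<dots> \<le> norm (T t f)"
      by (rule norm_lower_bound[OF pos_T[OF that(1)] that(3) \<open>0 \<le> h\<close>
            lower_bound_error[OF pos_T[OF that(1)] that(3) \<open>0 \<le> h\<close>]])
         (use t1[OF that(1,2)] in simp)
    finally show ?thesis .
  qed
  obtain t0 where t0: "t0 \<in> J" "t1 \<le> t0" using unbounded by blast
  have multiple: "real (Suc k) * t \<in> J" "blinfun_apply (T (real (Suc k) * t)) = blinfun_apply (T t) ^^ Suc k"
    if "t \<in> J" for k t
    using semigroup_multiple[OF sg that add] by auto
  have upper: "norm ((blinfun_apply (T t0) ^^ k) f) \<le> M * norm f" for k f
  proof (cases k)
    case 0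
    then show ?thesis using M(1) mult_right_mono[of 1 M "norm f"] by simp
  next
    case (Suc j)
    then show ?thesis using multiple[OF t0(1), of j] T_upper by metis
  qed
  have lower: "c * norm f \<le> norm ((blinfun_apply (T t0) ^^ k) f)" if "0 \<le> f" for k f
  proof (cases k)
    case 0
    then show ?thesis using c mult_right_mono[of c 1 "norm f"] by simp
  next
    case (Suc j)
    have "t0 \<le> real (Suc j) * t0" using J_pos[OF t0(1)] by (simp add: algebra_simps)
    then have "t1 \<le> real (Suc j) * t0" using t0(2) by linarith
    then show ?thesis using multiple[OF t0(1), of j] T_lower that Suc by metis
  qed
  have dominates: "\<exists>e\<ge>0. norm e \<le> c\<^sup>2 * norm h / (4 * M\<^sup>2) * norm f \<and> norm f *\<^sub>R h \<le> T t0 f + e"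
    if "0 \<le> f" for f
    by (rule lower_bound_error[OF pos_T[OF t0(1)] that \<open>0 \<le> h\<close>])
       (use t1[OF t0] in \<open>simp add: \<delta>_def\<close>)
  obtain f0 and \<phi> :: "'a \<Rightarrow>\<^sub>L real" and \<epsilon> C q where f0: "0 \<le> f0" "norm f0 = 1"
    "\<phi> f0 = 1" and \<epsilon>: "0 < \<epsilon>" "\<And>f. 0 \<le> f \<Longrightarrow> \<epsilon> * norm f \<le> \<phi> f"
    and q: "0 \<le> q" "q < 1"
    and rate: "\<And>k f. norm ((blinfun_apply (T t0) ^^ k) f - \<phi> f *\<^sub>R f0) \<le> C * q ^ k * norm f"
    by (rule powers_converge_to_rank_one[OF pos_T[OF t0(1)] c M(1) \<open>0 < h\<close> M(2) upper lower dominates])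
       (assumption | rule that | blast)+
  have q_lim: "(\<lambda>k. C * q ^ k * r) \<longlonglongrightarrow> 0" for r
    using q by (intro tendsto_mult_left_zero tendsto_mult_right_zero LIMSEQ_realpow_zero)
  have S_lim: "(\<lambda>k. (blinfun_apply (T t0) ^^ k) f) \<longlonglongrightarrow> \<phi> f *\<^sub>R f0" for f
    by (subst Lim_null, rule Lim_null_comparison[OF _ q_lim[of "norm f"]]) (simp add: rate)
  have \<phi>_nonneg: "0 \<le> \<phi> f" if "0 \<le> f" for f
    using \<epsilon>(2)[OF that] \<epsilon>(1) by (meson mult_nonneg_nonneg norm_ge_zero order_trans less_imp_le)
  \<comment> \<open>The limit projection commutes with \<open>T t\<close>, as the powers of \<open>T t0\<close> do.\<close>
  have commute: "\<phi> (T t f) *\<^sub>R f0 = \<phi> f *\<^sub>R T t f0" if "t \<in> J" for t f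
  proof (rule LIMSEQ_unique[OF S_lim])
    have "(blinfun_apply (T t0) ^^ k) (T t f) = T t ((blinfun_apply (T t0) ^^ k) f)" for k
    proof (induction k)
      case (Suc k)
      have "T t0 (T t g) = T t (T t0 g)" for g
        using comp[OF t0(1) that, of g] comp[OF that t0(1), of g] by (simp add: add.commute)
      then show ?case using Suc by simp
    qed simp
    then show "(\<lambda>k. (blinfun_apply (T t0) ^^ k) (T t f)) \<longlonglongrightarrow> \<phi> f *\<^sub>R T t f0"
      using tendsto_compose[OF _ S_lim[of f]] blinfun.tendsto[OF tendsto_const S_lim[of f], of "T t"]
      by (simp add: blinfun.scaleR_right)
  qed
  have f0_fixed: "T t f0 = f0" if t: "t \<in> J" for t
  proof -
    define l where "l = \<phi> (T t f0)"
    have eigen: "T t f0 = l *\<^sub>R f0"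
      using commute[OF t, of f0] f0(3) by (simp add: l_def)
    have "0 \<le> l"
      unfolding l_def using pos_T[OF t] f0(1) by (intro \<phi>_nonneg) (simp add: positive_op_def)
    have power: "(blinfun_apply (T t) ^^ k) f0 = l ^ k *\<^sub>R f0" for k
      by (induction k) (simp_all add: blinfun.scaleR_right eigen mult.commute)
    obtain N where N: "t1 / t \<le> real N" using real_arch_simple by blast
    have "c \<le> l ^ n \<and> l ^ n \<le> M" if n_ge: "Suc N \<le> n" for n
    proof -
      obtain j where n: "n = Suc j" using n_ge by (cases n) auto
      have "t1 / t \<le> real (Suc j)" using N n_ge n by simp
      then have "t1 \<le> real (Suc j) * t" using J_pos[OF t] by (simp add: field_simps)
      moreover have "norm (T (real (Suc j) * t) f0) = l ^ n"
        unfolding n multiple(2)[OF t] power using f0(2) \<open>0 \<le> l\<close> by simp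
      ultimately show ?thesis
        using T_lower[OF multiple(1)[OF t, of j] _ f0(1)] T_upper[OF multiple(1)[OF t, of j], of f0] f0(2) by simp
    qed
    then have "l = 1"
      using bounded_powers_eq_one[OF \<open>0 \<le> l\<close> c(1)] by blast
    then show ?thesis using eigen by simp
  qed
  have \<phi>_fixed: "\<phi> (T t f) = \<phi> f" if "t \<in> J" for t f
  proof -
    have "f0 \<noteq> 0" using f0(2) by auto
    then show ?thesis using commute[OF that, of f] f0_fixed[OF that] by simp
  qed
  have "(T \<longlongrightarrow> rank_one \<phi> f0) (at_top_in J)"
  proof (rule tendstoI)
    fix e :: real
    assume "0 < e"
    then have "\<forall>\<^sub>F k in sequentially. \<bar>C\<bar> * q ^ k * M < e"
      using q by (intro order_tendstoD(2)[of _ 0] tendsto_mult_left_zero tendsto_mult_right_zero LIMSEQ_realpow_zero)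
    then obtain j where "\<bar>C\<bar> * q ^ Suc j * M < e"
      unfolding eventually_sequentially using le_SucI order_refl by blast
    \<comment> \<open>The summand 1 keeps the remainder \<open>t - (j + 1) t0\<close> strictly positive, hence in \<open>J\<close>.\<close>
    moreover have "dist (T t) (rank_one \<phi> f0) \<le> \<bar>C\<bar> * q ^ Suc j * M"
      if t: "t \<in> J" "real (Suc j) * t0 + 1 \<le> t" for t
      unfolding dist_norm
    proof (rule norm_blinfun_bound)
      fix f
      let ?s = "real (Suc j) * t0"
      have s: "?s \<in> J" by (rule multiple(1)[OF t0(1)])
      have r: "t - ?s \<in> J" by (rule diff[OF s t(1)]) (use t(2) in linarith)
      have "T t f = T (?s + (t - ?s)) f" by simp
      also have "\<dots> = T ?s (T (t - ?s) f)" by (rule comp[OF s r])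
      finally have "T t f = (blinfun_apply (T t0) ^^ Suc j) (T (t - ?s) f)"
        by (simp only: multiple(2)[OF t0(1)])
      then have "norm (T t f - \<phi> f *\<^sub>R f0) \<le> C * q ^ Suc j * norm (T (t - ?s) f)"
        using rate[of "Suc j" "T (t - ?s) f"] by (simp only: \<phi>_fixed[OF r])
      also have "\<dots> \<le> \<bar>C\<bar> * q ^ Suc j * (M * norm f)"
        using q M by (intro mult_mono T_upper[OF r]) auto
      finally show "norm ((T t - rank_one \<phi> f0) f) \<le> \<bar>C\<bar> * q ^ Suc j * M * norm f"
        by (simp add: blinfun.diff_left mult.assoc)
    qed (use q M in auto)
    ultimately show "\<forall>\<^sub>F t in at_top_in J. dist (T t) (rank_one \<phi> f0) < e"
      unfolding eventually_at_top_in by (meson le_less_trans)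
  qed
  moreover have "fixed_vector J T f0" by (simp add: fixed_vector_def f0_fixed)
  moreover have "fixed_functional J T \<phi>"
    by (auto simp: fixed_functional_def adjoint_op_def \<phi>_fixed intro!: blinfun_eqI)
  moreover have "positive_op \<phi>" by (simp add: positive_op_def \<phi>_nonneg)
  ultimately show ?thesis using that f0 \<epsilon> by blast
qed

theorem corollary3p6:
  fixes J :: "real set" and T :: "real \<Rightarrow> 'a::al_space \<Rightarrow>\<^sub>L 'a"
  assumes "J = real ` {1..} \<or> J = {0<..}"
    and "bounded_semigroup J T"
    and "positive_semigroup J T"
  shows "(\<exists>f0 \<phi>. 0 \<le> f0 \<and> norm f0 = 1 \<and> fixed_vector J T f0
            \<and> positive_op \<phi> \<and> fixed_functional J T \<phi>
            \<and> blinfun_apply \<phi> f0 = 1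
            \<and> (\<exists>\<epsilon>>0. \<forall>f. 0 \<le> f \<and> norm f = 1 \<longrightarrow> \<epsilon> \<le> blinfun_apply \<phi> f)
            \<and> (T \<longlongrightarrow> rank_one \<phi> f0) (at_top_in J))
         \<longleftrightarrow>
         (\<exists>h>0. ((\<lambda>t. SUP f\<in>{f. 0 \<le> f \<and> norm f = 1}.
                     norm (neg_part (blinfun_apply (T t) f - h)))
                  \<longlongrightarrow> 0) (at_top_in J))"
    (is "?i \<longleftrightarrow> ?ii")
proof
  assume ?i
  then show ?ii using rank_one_limit_imp_lower_bound by blast
next
  assume ?ii
  then obtain h where h: "0 < h" "((\<lambda>t. SUP f\<in>{f. 0 \<le> f \<and> norm f = 1}.
      norm (neg_part (blinfun_apply (T t) f - h))) \<longlongrightarrow> 0) (at_top_in J)"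
    by blast
  have unbounded: "\<exists>t\<in>J. b \<le> t" for b
  proof -
    obtain n where "b \<le> real n" using real_arch_simple by blast
    then have "b \<le> real (Suc n)" by simp
    moreover have "real (Suc n) \<in> J" using assms(1) by (auto simp del: of_nat_Suc)
    ultimately show ?thesis by blast
  qed
  have J_pos: "0 < t" if "t \<in> J" for t
    using assms(1) that by auto
  have add: "s + t \<in> J" if st: "s \<in> J" "t \<in> J" for s t
    using assms(1)
  proof
    assume J: "J = real ` {1..}"
    then obtain m n where "s = real m" "t = real n" "1 \<le> m" "1 \<le> n" using st by auto
    then show ?thesis unfolding J by (intro image_eqI[of _ _ "m + n"]) auto
  qed (use st in auto)
  have diff: "t - s \<in> J" if st: "s \<in> J" "t \<in> J" "s < t" for s t
    using assms(1)
  proof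
    assume J: "J = real ` {1..}"
    then obtain m n where "s = real m" "t = real n" "m < n" using st by auto
    then show ?thesis unfolding J by (intro image_eqI[of _ _ "n - m"]) auto
  qed (use st in auto)
  obtain f0 \<phi> \<epsilon> where *: "0 \<le> f0" "norm f0 = 1" "fixed_vector J T f0" "positive_op \<phi>"
    "fixed_functional J T \<phi>" "blinfun_apply \<phi> f0 = 1" "0 < \<epsilon>"
    "\<And>f. 0 \<le> f \<Longrightarrow> \<epsilon> * norm f \<le> blinfun_apply \<phi> f" "(T \<longlongrightarrow> rank_one \<phi> f0) (at_top_in J)"
    using lower_bound_imp_rank_one_limit[OF unbounded J_pos add diff assms(2,3) h] by blast
  have "\<forall>f. 0 \<le> f \<and> norm f = 1 \<longrightarrow> \<epsilon> \<le> blinfun_apply \<phi> f"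
    using *(8) by fastforce
  then show ?i using * by blast
qed

end
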